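(* For any $2n\times2n$ complex symplectic matrix $S$, there exist a $2n\times 2n$ unitary symplectic matrix $U$ (a complex matrix that is both unitary and symplectic), a $2n\times 2n$ real symplectic matrix $Y$, and $n$ unique (up to order and signs) real numbers $\theta_1,\dots,\theta_n$ such that $$S=U\begin{bmatrix}Ch&iSh\\-iSh&Ch\end{bmatrix}Y.$$
   Context: A real (resp. complex) symplectic matrix is a real (resp. complex) $2n\times2n$ matrix $S$ with $S^TJ_nS=J_n$, where $J_n=\begin{bmatrix}0&I_n\\-I_n&0\end{bmatrix}$ and $^T$ is the ordinary (non-conjugate) transpose. $Ch=\operatorname{diag}(\cosh\theta_1,\dots,\cosh\theta_n)$ and $Sh=\operatorname{diag}(\sinh\theta_1,\dots,\sinh\theta_n)$. *)

theory Defs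
  imports
    Complex_Main
    "HOL-Combinatorics.Permutations"
    "Jordan_Normal_Form.Schur_Decomposition"
begin

definition J_mat :: "nat \<Rightarrow> 'a::comm_ring_1 mat" where
  "J_mat n = four_block_mat (0\<^sub>m n n) (1\<^sub>m n) (- 1\<^sub>m n) (0\<^sub>m n n)"

(* The plain (non-conjugate) transpose is meant for every scalar type; the type of the
   matrix decides between "real symplectic" and "complex symplectic". *)
definition symplectic :: "nat \<Rightarrow> 'a::comm_ring_1 mat \<Rightarrow> bool" where
  "symplectic n S \<longleftrightarrow>
     S \<in> carrier_mat (2 * n) (2 * n) \<and> transpose_mat S * J_mat n * S = J_mat n"

definition unitary :: "nat \<Rightarrow> complex mat \<Rightarrow> bool" where
  "unitary m U \<longleftrightarrow> U \<in> carrier_mat m m \<and> mat_adjoint U * U = 1\<^sub>m m"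

definition Ch_mat :: "nat \<Rightarrow> (nat \<Rightarrow> real) \<Rightarrow> complex mat" where
  "Ch_mat n \<theta> = mat_diag n (\<lambda>i. complex_of_real (cosh (\<theta> i)))"

definition Sh_mat :: "nat \<Rightarrow> (nat \<Rightarrow> real) \<Rightarrow> complex mat" where
  "Sh_mat n \<theta> = mat_diag n (\<lambda>i. complex_of_real (sinh (\<theta> i)))"

definition hyperbolic_mat :: "nat \<Rightarrow> (nat \<Rightarrow> real) \<Rightarrow> complex mat" where
  "hyperbolic_mat n \<theta> =
     four_block_mat (Ch_mat n \<theta>) (\<i> \<cdot>\<^sub>m Sh_mat n \<theta>)
                    ((- \<i>) \<cdot>\<^sub>m Sh_mat n \<theta>) (Ch_mat n \<theta>)"

(* The parameters are indexed by 0, ..., n - 1; values outside that range are ignored.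
   The sign may be chosen separately for each index. *)
definition eq_up_to_order_and_signs ::
    "nat \<Rightarrow> (nat \<Rightarrow> real) \<Rightarrow> (nat \<Rightarrow> real) \<Rightarrow> bool" where
  "eq_up_to_order_and_signs n \<theta> \<theta>' \<longleftrightarrow>
     (\<exists>p. p permutes {..<n} \<and> (\<forall>i<n. \<theta>' i = \<theta> (p i) \<or> \<theta>' i = - \<theta> (p i)))"

end

(* Write S^* for the adjoint of S. If S = U H Y with U unitary symplectic, Y real symplectic and
   H = hyperbolic_mat, then Y J Y^* = J, so the Hermitian matrix G = i S J S^* equals U (i H J H) U^*,
   and i H J H has the eigenvalues exp (2 theta_i) and - exp (- 2 theta_i). Thus the theta_i are read
   off the positive eigenvalues of G (the signs are determined too).

   Conversely, G satisfies G J cnj G = - J, so if v is an eigenvector for a, then J cnj v is one for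
   - 1/a. An orthonormal basis L of the positive eigenspaces together with - J cnj L forms a unitary
   matrix that is also symplectic and diagonalizes G; this yields U and theta. Then Y = H^-1 U^* S is
   symplectic with Y J Y^* = J = Y J Y^T, hence real. *)

theory Submission
  imports Defs
begin

section \<open>The spectral theorem for Hermitian matrices\<close>

text \<open>The choice of G: multiplying S on the right by a complex symplectic Y leaves G unchanged
  exactly when Y is real, so G records S precisely up to a real symplectic factor, while a unitary
  factor on the left merely conjugates G. The decomposition thus becomes a question about one
  Hermitian matrix. The obstacle is that its eigenbasis has to be orthonormal and compatible with
  the antilinear map v -> J cnj v at the same time; when eigenvalues repeat, an arbitrary
  orthonormal eigenbasis is not compatible. Hence only the positive half is chosen freely, and this
  needs exactly n positive eigenvalues counted with multiplicity. That count comes from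
  diagonalizing the inverse of G in two ways. Eigenspaces never appear as such: a diagonalization is
  an equation A V = V D with V unitary, and multiplicities are those of the linear factors of the
  characteristic polynomial.\<close>

lemma mat_adjoint_conv: "mat_adjoint A = transpose_mat (map_mat cnj A)"
  by (rule eq_matI) (auto simp: mat_adjoint_def mat_of_rows_def)

lemma mat_adjoint_dim[simp]:
  "dim_row (mat_adjoint (A :: complex mat)) = dim_col A"
  "dim_col (mat_adjoint (A :: complex mat)) = dim_row A"
  by (simp_all add: mat_adjoint_conv)

lemma mat_adjoint_index[simp]:
  "i < dim_col A \<Longrightarrow> j < dim_row A \<Longrightarrow> mat_adjoint A $$ (i, j) = cnj (A $$ (j, i))"
  by (simp add: mat_adjoint_conv)

lemma mat_adjoint_carrier[simp]:
  "A \<in> carrier_mat m n \<Longrightarrow> mat_adjoint (A :: complex mat) \<in> carrier_mat n m"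
  by (simp add: mat_adjoint_conv)

lemma mat_adjoint_adjoint[simp]: "mat_adjoint (mat_adjoint A) = (A :: complex mat)"
  by (rule eq_matI) auto

lemma mat_cnj_mult:
  "A \<in> carrier_mat m n \<Longrightarrow> B \<in> carrier_mat n k \<Longrightarrow>
    map_mat cnj (A * B) = map_mat cnj A * map_mat cnj B"
  by (rule eq_matI) (auto simp: scalar_prod_def)

lemma mat_adjoint_mult:
  assumes "A \<in> carrier_mat m n" "B \<in> carrier_mat n k"
  shows "mat_adjoint (A * B) = mat_adjoint B * mat_adjoint (A :: complex mat)"
  using assms by (simp add: mat_adjoint_conv mat_cnj_mult transpose_mult[of _ m n _ k])

lemma unitary_carrier: "unitary n U \<Longrightarrow> U \<in> carrier_mat n n"
  and unitary_left_inv: "unitary n U \<Longrightarrow> mat_adjoint U * U = 1\<^sub>m n"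
  by (simp_all add: unitary_def)

lemma unitary_right_inv: "unitary n U \<Longrightarrow> U * mat_adjoint U = 1\<^sub>m n"
  by (metis unitary_def mat_adjoint_carrier mat_mult_left_right_inverse)

lemma unitary_mult:
  assumes "unitary n U" "unitary n V"
  shows "unitary n (U * V)"
proof -
  have c: "U \<in> carrier_mat n n" "V \<in> carrier_mat n n"
    using assms by (auto simp: unitary_def)
  have "mat_adjoint (U * V) * (U * V) = mat_adjoint V * (mat_adjoint U * U) * V"
    using c by (simp add: mat_adjoint_mult[of _ n n _ n] assoc_mult_mat[of _ n n _ n _ n]
        mult_carrier_mat[of _ n n _ n])
  then show ?thesis
    using assms c by (simp add: unitary_def mult_carrier_mat[of _ n n _ n])
qed

lemma unitary_adjoint: "unitary n U \<Longrightarrow> unitary n (mat_adjoint U)"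
  by (simp add: unitary_def) (metis unitary_def unitary_right_inv)

text \<open>Complete v to a basis and orthogonalize. \<open>gram_schmidt\<close> keeps the head of
  the list, so the first column is v up to the normalizing factor c.\<close>

lemma unitary_first_col:
  fixes v :: "complex vec"
  assumes v: "v \<in> carrier_vec n" and v0: "v \<noteq> 0\<^sub>v n"
  shows "\<exists>W c. unitary n W \<and> col W 0 = c \<cdot>\<^sub>v v"
proof -
  interpret cof_vec_space n "TYPE(complex)" .
  define b where "b = basis_completion v"
  define ws where "ws = gram_schmidt n b"
  from basis_completion[OF v v0, folded b_def]
  have b: "distinct b" "\<not> lin_dep (set b)" "set b \<subseteq> carrier_vec n" "hd b = v" "length b = n"
    by auto
  have n: "n > 0" using v v0 by (cases n) auto
  then obtain vs where bv: "b = v # vs" using b by (cases b) auto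
  from gram_schmidt_result[OF b(3,1,2) refl, folded ws_def]
  have ws: "set ws \<subseteq> carrier_vec n" "corthogonal ws" "length ws = n" using b by auto
  have hdws: "hd ws = v"
    using gram_schmidt_hd[OF v, of vs, folded bv] unfolding ws_def .
  have wsi: "ws ! i \<in> carrier_vec n" if "i < n" for i
    using ws that by auto
  define q where "q i = Re (ws ! i \<bullet>c ws ! i)" for i
  have q: "ws ! i \<bullet>c ws ! i = complex_of_real (q i)" "q i > 0" if "i < n" for i
  proof -
    have "ws ! i \<bullet>c ws ! i \<noteq> 0"
      using ws that by (auto simp: corthogonal_def)
    moreover have "ws ! i \<bullet>c ws ! i \<ge> 0"
      by (rule conjugate_square_ge_0_vec)
    ultimately show "ws ! i \<bullet>c ws ! i = complex_of_real (q i)" "q i > 0"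
      unfolding q_def by (auto simp: less_eq_complex_def complex_eq_iff)
  qed
  \<comment> \<open>\<open>gram_schmidt\<close> gives orthogonal vectors of arbitrary length; these
    factors bring them to length 1.\<close>
  define r where "r i = complex_of_real (1 / sqrt (q i))" for i
  define W where "W = mat n n (\<lambda>(i,j). r j * ws ! j $ i)"
  have W: "W \<in> carrier_mat n n" by (simp add: W_def)
  have "mat_adjoint W * W = 1\<^sub>m n"
  proof (rule eq_matI)
    fix i j assume ij: "i < dim_row (1\<^sub>m n)" "j < dim_col (1\<^sub>m n)"
    then have ij: "i < n" "j < n" by auto
    have "(mat_adjoint W * W) $$ (i,j) = (\<Sum>k<n. cnj (W $$ (k,i)) * W $$ (k,j))"
      using ij W by (auto simp: scalar_prod_def atLeast0LessThan)
    also have "\<dots> = (\<Sum>k<n. r i * r j * (ws ! j $ k * cnj (ws ! i $ k)))"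
      using ij by (intro sum.cong) (auto simp: W_def r_def)
    also have "\<dots> = r i * r j * (ws ! j \<bullet>c ws ! i)"
      using wsi[OF ij(1)] wsi[OF ij(2)]
      by (simp add: scalar_prod_def sum_distrib_left atLeast0LessThan)
    also have "\<dots> = 1\<^sub>m n $$ (i,j)"
    proof (cases "i = j")
      case True
      have "r i * r i * complex_of_real (q i) = complex_of_real (1 / sqrt (q i) * (1 / sqrt (q i)) * q i)"
        by (simp only: r_def of_real_mult)
      also have "1 / sqrt (q i) * (1 / sqrt (q i)) * q i = 1"
        using q(2)[OF ij(1)] by simp
      finally show ?thesis using True q(1)[OF ij(1)] ij by (simp del: of_real_mult)
    next
      case False
      then show ?thesis using ws ij by (auto simp: corthogonal_def)
    qed
    finally show "(mat_adjoint W * W) $$ (i,j) = 1\<^sub>m n $$ (i,j)" .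
  qed (use W in auto)
  moreover have "ws ! 0 = v"
    using n hdws ws by (cases ws) auto
  then have "col W 0 = r 0 \<cdot>\<^sub>v v"
    using n v by (intro eq_vecI) (auto simp: W_def)
  ultimately show ?thesis
    using W unfolding unitary_def by blast
qed

text \<open>Deflation: conjugating by a unitary matrix whose first column is an eigenvector for the
  head of \<open>es\<close> splits off a 1 x 1 block, and the remaining block is Hermitian with the
  tail as its roots. The diagonal follows the order of the given list, which later allows the
  positive eigenvalues to be placed in front.\<close>

lemma hermitian_diagonalization:
  fixes A :: "complex mat"
  assumes "A \<in> carrier_mat n n" "mat_adjoint A = A"
    and "char_poly A = (\<Prod>e\<leftarrow>es. [:- e, 1:])"
  shows "\<exists>V. unitary n V \<and> A * V = V * mat_diag n (\<lambda>i. es ! i)"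
  using assms
proof (induction es arbitrary: n A)
  case Nil
  then have "n = 0" using degree_monic_char_poly[of A n] by simp
  then show ?case
    using Nil by (intro exI[of _ "1\<^sub>m 0"]) (auto simp: unitary_def mat_diag_def)
next
  case (Cons e es n A)
  have A: "A \<in> carrier_mat n n" by fact
  have "poly (char_poly A) e = 0" using Cons.prems by simp
  then obtain v where "eigenvector A v e"
    using eigenvalue_root_char_poly[OF A] unfolding eigenvalue_def by blast
  then have v: "v \<in> carrier_vec n" "v \<noteq> 0\<^sub>v n" "A *\<^sub>v v = e \<cdot>\<^sub>v v"
    using A by (auto simp: eigenvector_def)
  define m where "m = n - 1"
  have n: "n = Suc m" using v by (cases n) (auto simp: m_def)
  then have n0: "0 < n" by simp
  obtain W c where W: "unitary n W" and col: "col W 0 = c \<cdot>\<^sub>v v"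
    using unitary_first_col[OF v(1,2)] by blast
  note Wc = unitary_carrier[OF W]
  note [simp] = A Wc mult_carrier_mat[of _ n n _ n]
  note assoc = assoc_mult_mat[of _ n n _ n _ n]
  define A' where "A' = mat_adjoint W * A * W"
  have A'c[simp]: "A' \<in> carrier_mat n n" by (simp add: A'_def)
  have A'd: "dim_row A' = n" "dim_col A' = n" using A'c by blast+
  have herm: "mat_adjoint A' = A'"
    using Cons.prems(2) by (simp add: A'_def mat_adjoint_mult[of _ n n _ n] assoc)
  have WA': "W * A' = A * W"
  proof -
    have "W * A' = (W * mat_adjoint W) * (A * W)" by (simp add: A'_def assoc)
    then show ?thesis
      using unitary_right_inv[OF W] left_mult_one_mat[of "A * W" n n] by simp
  qed
  have "col A' 0 = mat_adjoint W *\<^sub>v (A *\<^sub>v col W 0)"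
    using n0 by (simp add: A'_def assoc col_mult2[of "mat_adjoint W" n n "A * W" n 0]
        col_mult2[of A n n W n 0])
  also have "A *\<^sub>v col W 0 = e \<cdot>\<^sub>v col W 0"
    unfolding col using v A by (simp add: mult_mat_vec[of A n n] smult_smult_assoc mult.commute)
  also have "mat_adjoint W *\<^sub>v (e \<cdot>\<^sub>v col W 0) = e \<cdot>\<^sub>v col (mat_adjoint W * W) 0"
    using n0 by (simp add: mult_mat_vec[of _ n n] col_mult2[of _ n n _ n])
  also have "\<dots> = e \<cdot>\<^sub>v unit_vec n 0"
    using unitary_left_inv[OF W] n by simp
  finally have colA': "col A' 0 = e \<cdot>\<^sub>v unit_vec n 0" .
  have A'0: "A' $$ (i, 0) = (if i = 0 then e else 0)" if "i < n" for i
    using arg_cong[OF colA', of "\<lambda>w. w $ i"] that n0 A'd by simp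
  \<comment> \<open>Hermitian symmetry carries the zeros of the first column over to the first row,
    so the splitting is block diagonal and not merely block triangular.\<close>
  have A'0': "A' $$ (0, j) = 0" if "0 < j" "j < n" for j
    using arg_cong[OF herm, of "\<lambda>w. w $$ (0, j)"] A'0[of j] that n0 A'd by simp
  define A3 where "A3 = mat m m (\<lambda>(i,j). A' $$ (Suc i, Suc j))"
  define A1 where "A1 = mat 1 1 (\<lambda>_. e)"
  have A3[simp]: "A3 \<in> carrier_mat m m" and A1[simp]: "A1 \<in> carrier_mat (Suc 0) (Suc 0)"
    by (simp_all add: A3_def A1_def)
  have blk: "A' = four_block_mat A1 (0\<^sub>m 1 m) (0\<^sub>m m 1) A3"
    by (rule eq_matI) (auto simp: A1_def A3_def n A'0 A'0' A'd)
  have "mat_adjoint A3 = A3"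
  proof (rule eq_matI)
    fix i j assume "i < dim_row A3" "j < dim_col A3"
    then show "mat_adjoint A3 $$ (i,j) = A3 $$ (i,j)"
      using arg_cong[OF herm, of "\<lambda>w. w $$ (Suc i, Suc j)"] n A'd by (simp add: A3_def)
  qed (auto simp: A3_def)
  moreover have "char_poly A3 = (\<Prod>e\<leftarrow>es. [:- e, 1:])"
  proof -
    have "similar_mat_wit A' A (mat_adjoint W) W"
      by (rule similar_mat_witI[of _ _ n])
        (use unitary_left_inv[OF W] unitary_right_inv[OF W] in \<open>auto simp: A'_def\<close>)
    then have "char_poly A' = char_poly A"
      by (intro char_poly_similar) (auto simp: similar_mat_def)
    moreover have "char_poly A' = char_poly A1 * char_poly A3"
      unfolding blk by (rule char_poly_four_block_zeros_col) auto
    moreover have "char_poly A1 = [:-e, 1:]"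
      by (simp add: A1_def char_poly_defs det_def sign_def)
    ultimately have "[:-e, 1:] * char_poly A3 = [:-e, 1:] * (\<Prod>e\<leftarrow>es. [:- e, 1:])"
      using Cons.prems(3) by simp
    then show ?thesis by (metis mult_cancel_left pCons_eq_0_iff zero_neq_one)
  qed
  ultimately obtain V where V: "unitary m V" and AV: "A3 * V = V * mat_diag m (\<lambda>i. es ! i)"
    using Cons.IH[OF A3] by blast
  note Vc[simp] = unitary_carrier[OF V] and [simp] = carrier_matD[OF unitary_carrier[OF V]]
  define F where "F = four_block_mat (1\<^sub>m 1) (0\<^sub>m 1 m) (0\<^sub>m m 1) V"
  have F[simp]: "F \<in> carrier_mat n n" 
    unfolding F_def n using four_block_carrier_mat[OF one_carrier_mat[of 1] Vc] by simp
  have adjF: "mat_adjoint F = four_block_mat (1\<^sub>m 1) (0\<^sub>m 1 m) (0\<^sub>m m 1) (mat_adjoint V)"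
    by (rule eq_matI) (auto simp: F_def)
  have "mat_adjoint F * F = 1\<^sub>m n"
    unfolding adjF unfolding F_def
    by (subst mult_four_block_mat[of _ 1 1 _ m _ m _ _ 1 _ m])
      (auto simp: unitary_left_inv[OF V] n)
  then have UF: "unitary n F" by (simp add: unitary_def)
  have D: "mat_diag n (\<lambda>i. (e # es) ! i) =
      four_block_mat A1 (0\<^sub>m 1 m) (0\<^sub>m m 1) (mat_diag m (\<lambda>i. es ! i))"
    by (rule eq_matI) (auto simp: mat_diag_def A1_def n nth_Cons')
  have "A' * F = F * mat_diag n (\<lambda>i. (e # es) ! i)"
    unfolding blk D F_def
    by (subst (1 2) mult_four_block_mat[of _ 1 1 _ m _ m _ _ 1 _ m])
      (auto simp: AV right_mult_one_mat[OF A1] left_mult_one_mat[OF A1] right_mult_zero_mat[OF A3]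
        right_mult_zero_mat[OF A1] left_mult_zero_mat[OF A1] right_add_zero_mat[OF A1] left_add_zero_mat[of _ m m]
        left_mult_zero_mat[of "mat_diag m f" m m for f] mult_carrier_mat[of _ m m _ m])
  then have "A * (W * F) = (W * F) * mat_diag n (\<lambda>i. (e # es) ! i)"
    using WA' assoc[of A W F] assoc[of W A' F] assoc[of W F "mat_diag n (\<lambda>i. (e # es) ! i)"] by simp
  then show ?case using unitary_mult[OF W UF] by blast
qed

text \<open>The diagonal matrix equals \<open>mat_adjoint V * A * V\<close>, hence is Hermitian
  itself.\<close>

lemma hermitian_eigenvalues_real:
  assumes A: "A \<in> carrier_mat n n" "mat_adjoint A = A"
    and V: "unitary n V" "A * V = V * mat_diag n f" and i: "i < n"
  shows "cnj (f i) = f i"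
proof -
  note [simp] = A(1) unitary_carrier[OF V(1)] mult_carrier_mat[of _ n n _ n]
  note assoc = assoc_mult_mat[of _ n n _ n _ n]
  have "mat_adjoint V * A * V = (mat_adjoint V * V) * mat_diag n f"
    by (simp add: assoc V(2))
  then have D: "mat_adjoint V * A * V = mat_diag n f"
    using unitary_left_inv[OF V(1)] left_mult_one_mat[of "mat_diag n f" n n] by simp
  have "mat_adjoint (mat_adjoint V * A * V) = mat_adjoint V * A * V"
    using A(2) by (simp add: mat_adjoint_mult[of _ n n _ n] assoc)
  then have "mat_adjoint (mat_diag n f) $$ (i,i) = mat_diag n f $$ (i,i)"
    unfolding D by simp
  then show ?thesis using i by (simp add: mat_diag_def)
qed

lemma char_poly_unitary_diag:
  assumes A: "A \<in> carrier_mat n n" and V: "unitary n V" "A * V = V * mat_diag n f"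
  shows "char_poly A = (\<Prod>e\<leftarrow>map f [0..<n]. [:- e, 1:])"
proof -
  note [simp] = A unitary_carrier[OF V(1)] mult_carrier_mat[of _ n n _ n]
  note assoc = assoc_mult_mat[of _ n n _ n _ n]
  have "V * mat_diag n f * mat_adjoint V = A * (V * mat_adjoint V)"
    by (simp add: assoc flip: V(2))
  then have "A = V * mat_diag n f * mat_adjoint V"
    using unitary_right_inv[OF V(1)] right_mult_one_mat[OF A] by simp
  then have "similar_mat_wit A (mat_diag n f) V (mat_adjoint V)"
    using unitary_right_inv[OF V(1)] unitary_left_inv[OF V(1)]
    by (intro similar_mat_witI[of _ _ n]) auto
  then have "char_poly A = char_poly (mat_diag n f)"
    by (intro char_poly_similar) (auto simp: similar_mat_def)
  also have "\<dots> = (\<Prod>e\<leftarrow>diag_mat (mat_diag n f). [:- e, 1:])"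
    by (rule char_poly_upper_triangular[of _ n]) (auto simp: mat_diag_def)
  also have "diag_mat (mat_diag n f) = map f [0..<n]"
    by (simp add: diag_mat_def mat_diag_def)
  finally show ?thesis .
qed

text \<open>\<open>proots\<close> recovers the list up to order. Together with
  \<open>char_poly_unitary_diag\<close> this shows that two diagonalizations of one matrix have the
  same eigenvalues with multiplicity.\<close>

lemma mset_roots_unique:
  fixes as bs :: "'a :: idom list"
  assumes "(\<Prod>a\<leftarrow>as. [:- a, 1:]) = (\<Prod>a\<leftarrow>bs. [:- a, 1:])"
  shows "mset as = mset bs"
proof -
  have nz: "(\<Prod>a\<leftarrow>as. [:- a, 1:]) \<noteq> 0" for as :: "'a list"
    by (induction as) (simp_all del: mult_pCons_left)
  have "proots (\<Prod>a\<leftarrow>as. [:- a, 1:]) = mset as" for as :: "'a list"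
    by (induction as) (simp_all add: proots_mult[OF _ nz] del: mult_pCons_left)
  then show ?thesis using assms by metis
qed

section \<open>Matrices with diagonal blocks\<close>

text \<open>Up to a simultaneous reordering of rows and columns this is a direct sum of n
  independent 2 x 2 matrices. J, the hyperbolic factor and the rotation below all have this shape,
  so identities between them reduce to scalar identities for each index.\<close>

definition diag_blocks ::
    "nat \<Rightarrow> (nat \<Rightarrow> 'a) \<Rightarrow> (nat \<Rightarrow> 'a) \<Rightarrow> (nat \<Rightarrow> 'a) \<Rightarrow> (nat \<Rightarrow> 'a) \<Rightarrow> 'a::zero mat" where
  "diag_blocks n a b c d =
     four_block_mat (mat_diag n a) (mat_diag n b) (mat_diag n c) (mat_diag n d)"

lemma mat_diag_dims[simp]: "dim_row (mat_diag n f) = n" "dim_col (mat_diag n f) = n"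
  by (simp_all add: mat_diag_def)

lemma mat_diag_index[simp]:
  "i < n \<Longrightarrow> j < n \<Longrightarrow> mat_diag n f $$ (i, j) = (if i = j then f j else 0)"
  by (simp add: mat_diag_def)

lemma mat_diag_add: "mat_diag n f + mat_diag n g = mat_diag n (\<lambda>i. f i + g i :: 'a :: monoid_add)"
  by (rule eq_matI) auto

lemma diag_blocks_carrier[simp]: "diag_blocks n a b c d \<in> carrier_mat (2 * n) (2 * n)"
  by (rule carrier_matI) (simp_all add: diag_blocks_def)

lemma diag_blocks_mult:
  fixes a b c d a' b' c' d' :: "nat \<Rightarrow> 'a :: semiring_0"
  shows "diag_blocks n a b c d * diag_blocks n a' b' c' d' =
    diag_blocks n (\<lambda>i. a i * a' i + b i * c' i) (\<lambda>i. a i * b' i + b i * d' i)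
      (\<lambda>i. c i * a' i + d i * c' i) (\<lambda>i. c i * b' i + d i * d' i)"
  unfolding diag_blocks_def
  by (subst mult_four_block_mat[of _ n n _ n _ n _ _ n _ n]) (auto simp: mat_diag_add)

lemma diag_blocks_transpose: "transpose_mat (diag_blocks n a b c d) = diag_blocks n a c b d"
  by (rule eq_matI) (auto simp: diag_blocks_def)

lemma diag_blocks_map:
  "f 0 = 0 \<Longrightarrow> map_mat f (diag_blocks n a b c d) =
    diag_blocks n (\<lambda>i. f (a i)) (\<lambda>i. f (b i)) (\<lambda>i. f (c i)) (\<lambda>i. f (d i))"
  by (rule eq_matI) (auto simp: diag_blocks_def)

lemma diag_blocks_uminus:
  "- diag_blocks n a b c d =
    diag_blocks n (\<lambda>i. - a i) (\<lambda>i. - b i) (\<lambda>i. - c i) (\<lambda>i. - d i :: 'a :: group_add)"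
  by (rule eq_matI) (auto simp: diag_blocks_def)

lemma diag_blocks_smult:
  "k \<cdot>\<^sub>m diag_blocks n a b c d =
    diag_blocks n (\<lambda>i. k * a i) (\<lambda>i. k * b i) (\<lambda>i. k * c i) (\<lambda>i. k * d i :: 'a :: semiring_0)"
  by (rule eq_matI) (auto simp: diag_blocks_def)

lemma diag_blocks_adjoint:
  "mat_adjoint (diag_blocks n a b c d) =
    diag_blocks n (\<lambda>i. cnj (a i)) (\<lambda>i. cnj (c i)) (\<lambda>i. cnj (b i)) (\<lambda>i. cnj (d i))"
  by (simp add: mat_adjoint_conv diag_blocks_map diag_blocks_transpose)

lemma diag_blocks_cong:
  assumes "\<And>i. i < n \<Longrightarrow> a i = a' i \<and> b i = b' i \<and> c i = c' i \<and> d i = d' i"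
  shows "diag_blocks n a b c d = diag_blocks n a' b' c' d'"
  by (rule eq_matI) (use assms in \<open>auto simp: diag_blocks_def\<close>)

lemma one_mat_diag_blocks: "1\<^sub>m (2 * n) = diag_blocks n (\<lambda>_. 1) (\<lambda>_. 0) (\<lambda>_. 0) (\<lambda>_. 1)"
  by (rule eq_matI) (auto simp: diag_blocks_def)

lemma mat_diag_diag_blocks:
  "mat_diag (2 * n) f = diag_blocks n f (\<lambda>_. 0) (\<lambda>_. 0) (\<lambda>i. f (i + n))"
  by (rule eq_matI) (auto simp: diag_blocks_def)

lemma J_mat_diag_blocks: "J_mat n = diag_blocks n (\<lambda>_. 0) (\<lambda>_. 1) (\<lambda>_. - 1) (\<lambda>_. 0)"
  by (rule eq_matI) (auto simp: diag_blocks_def J_mat_def)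

lemma hyperbolic_mat_diag_blocks:
  "hyperbolic_mat n \<theta> =
    diag_blocks n (\<lambda>i. of_real (cosh (\<theta> i))) (\<lambda>i. \<i> * of_real (sinh (\<theta> i)))
      (\<lambda>i. - \<i> * of_real (sinh (\<theta> i))) (\<lambda>i. of_real (cosh (\<theta> i)))"
  by (rule eq_matI) (auto simp: diag_blocks_def hyperbolic_mat_def Ch_mat_def Sh_mat_def)

section \<open>Symplectic matrices\<close>

lemma J_mat_carrier[simp]: "J_mat n \<in> carrier_mat (2 * n) (2 * n)"
  by (simp add: J_mat_diag_blocks)

lemma J_mat_square: "J_mat n * J_mat n = - 1\<^sub>m (2 * n)"
  by (simp add: J_mat_diag_blocks diag_blocks_mult one_mat_diag_blocks diag_blocks_uminus)

lemma J_mat_cnj: "map_mat cnj (J_mat n) = J_mat n"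
  by (simp add: J_mat_diag_blocks diag_blocks_map)

lemma J_mat_of_real: "map_mat complex_of_real (J_mat n) = J_mat n"
  by (simp add: J_mat_diag_blocks diag_blocks_map)

lemma J_mat_adjoint: "mat_adjoint (J_mat n :: complex mat) = - J_mat n"
  by (simp add: J_mat_diag_blocks diag_blocks_adjoint diag_blocks_uminus)

lemma J_mat_J_mat_mult:
  "A \<in> carrier_mat (2 * n) m \<Longrightarrow> J_mat n * (J_mat n * A) = - A"
  by (simp add: J_mat_square flip: assoc_mult_mat[of _ "2 * n" "2 * n" _ "2 * n" _ m])

lemma symplectic_carrier: "symplectic n S \<Longrightarrow> S \<in> carrier_mat (2 * n) (2 * n)"
  by (simp add: symplectic_def)

lemma symplectic_mult:
  assumes "symplectic n A" "symplectic n B"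
  shows "symplectic n (A * B)"
proof -
  note [simp] = assms[THEN symplectic_carrier] mult_carrier_mat[of _ "2*n" "2*n" _ "2*n"]
  note assoc = assoc_mult_mat[of _ "2*n" "2*n" _ "2*n" _ "2*n"]
  have "transpose_mat (A * B) * J_mat n * (A * B) =
      transpose_mat B * (transpose_mat A * J_mat n * A) * B"
    by (simp add: transpose_mult[of _ "2*n" "2*n" _ "2*n"] assoc)
  also have "\<dots> = J_mat n" using assms by (simp add: symplectic_def)
  finally show ?thesis by (simp add: symplectic_def)
qed

text \<open>Since J squares to -1, the matrix \<open>- (J_mat n * transpose_mat S * J_mat n)\<close>
  is a left inverse of S; for square matrices it is also a right inverse.\<close>

lemma symplectic_right:
  fixes S :: "'a :: field mat"
  assumes "symplectic n S"
  shows "S * J_mat n * transpose_mat S = J_mat n"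
proof -
  note [simp] = assms[THEN symplectic_carrier] carrier_matD[OF assms[THEN symplectic_carrier]]
    carrier_matD[OF J_mat_carrier] mult_carrier_mat[of _ "2*n" "2*n" _ "2*n"]
  note assoc = assoc_mult_mat[of _ "2*n" "2*n" _ "2*n" _ "2*n"]
  have "J_mat n * (transpose_mat S * J_mat n * S) = - 1\<^sub>m (2 * n)"
    using assms by (simp add: symplectic_def J_mat_square)
  then have "- (J_mat n * transpose_mat S * J_mat n) * S = 1\<^sub>m (2 * n)"
    by (simp add: assoc)
  then have "S * - (J_mat n * transpose_mat S * J_mat n) = 1\<^sub>m (2 * n)"
    by (rule mat_mult_left_right_inverse[rotated 2]) auto
  then have "S * - (J_mat n * transpose_mat S * J_mat n) * J_mat n = 1\<^sub>m (2 * n) * J_mat n"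
    by simp
  then show ?thesis
    by (simp add: assoc J_mat_square)
qed

lemma symplectic_transpose: "symplectic n S \<Longrightarrow> symplectic n (transpose_mat S :: 'a :: field mat)"
  using symplectic_right[of n S] by (simp add: symplectic_def)

lemma symplectic_cnj:
  assumes "symplectic n S"
  shows "symplectic n (map_mat cnj S)"
proof -
  note [simp] = symplectic_carrier[OF assms] mult_carrier_mat[of _ "2*n" "2*n" _ "2*n"]
  have "transpose_mat (map_mat cnj S) * J_mat n * map_mat cnj S =
      map_mat cnj (transpose_mat S * J_mat n * S)"
    unfolding map_mat_transpose by (simp add: mat_cnj_mult[of _ "2*n" "2*n" _ "2*n"] J_mat_cnj)
  also have "\<dots> = J_mat n"
    using assms by (simp add: symplectic_def J_mat_cnj)
  finally show ?thesis by (simp add: symplectic_def)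
qed

lemma symplectic_adjoint: "symplectic n S \<Longrightarrow> symplectic n (mat_adjoint (S :: complex mat))"
  unfolding mat_adjoint_conv by (intro symplectic_transpose symplectic_cnj)

text \<open>A unitary matrix is symplectic as soon as it is quaternionic, i.e. commutes with the
  antilinear map \<open>v \<mapsto> J cnj v\<close>.\<close>

lemma symplectic_if_quaternionic:
  assumes U: "unitary (2 * n) U" and J: "J_mat n * map_mat cnj U = U * J_mat n"
  shows "symplectic n U"
proof -
  note [simp] = unitary_carrier[OF U] carrier_matD[OF unitary_carrier[OF U]]
    carrier_matD[OF J_mat_carrier] mult_carrier_mat[of _ "2*n" "2*n" _ "2*n"]
  note assoc = assoc_mult_mat[of _ "2*n" "2*n" _ "2*n" _ "2*n"]
  \<comment> \<open>Solving the hypothesis for \<open>map_mat cnj U\<close> and taking adjoints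
    expresses the transpose of U through its adjoint, so that unitarity can be applied.\<close>
  have "map_mat cnj U = - (J_mat n * (J_mat n * map_mat cnj U))"
    by (simp add: J_mat_J_mat_mult[of _ _ "2*n"])
  also have "\<dots> = - (J_mat n * (U * J_mat n))" by (simp only: J)
  finally have "mat_adjoint (map_mat cnj U) = mat_adjoint (- (J_mat n * (U * J_mat n)))" by simp
  moreover have "mat_adjoint (map_mat cnj U) = transpose_mat U"
    by (rule eq_matI) auto
  moreover have "mat_adjoint (- A) = - mat_adjoint A" for A :: "complex mat"
    by (rule eq_matI) auto
  ultimately have T: "transpose_mat U = - (J_mat n * mat_adjoint U * J_mat n)"
    by (simp add: mat_adjoint_mult[of _ "2*n" "2*n" _ "2*n"] J_mat_adjoint assoc)
  have "transpose_mat U * J_mat n * U = J_mat n * (mat_adjoint U * U)"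
    by (simp add: T assoc J_mat_J_mat_mult[of _ _ "2*n"])
  also have "\<dots> = J_mat n"
    unfolding unitary_left_inv[OF U] by (rule right_mult_one_mat[OF J_mat_carrier])
  finally show ?thesis by (simp add: symplectic_def)
qed

section \<open>Symplectic diagonalization\<close>

lemma prod_list_map_mset:
  fixes f :: "'a \<Rightarrow> 'b :: comm_monoid_mult"
  assumes "mset xs = mset ys"
  shows "(\<Prod>x\<leftarrow>xs. f x) = (\<Prod>x\<leftarrow>ys. f x)"
proof -
  have "prod_list (map f xs) = prod_mset (image_mset f (mset xs))" for xs
    by (simp flip: prod_mset_prod_list)
  then show ?thesis using assms by simp
qed

text \<open>The inverse of a Hermitian \<open>G\<close> with \<open>G J cnj G = - J\<close> is \<open>J cnj G J\<close>, which is unitarily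
  similar to \<open>- cnj G\<close>. Hence the spectrum is invariant under \<open>x \<mapsto> - 1 / x\<close>, which swaps
  positive and negative eigenvalues.\<close>

lemma quaternionic_spectrum:
  fixes G :: "complex mat"
  assumes G: "G \<in> carrier_mat (2 * n) (2 * n)" "mat_adjoint G = G"
    and GJG: "G * J_mat n * map_mat cnj G = - J_mat n"
  shows "\<exists>ps qs. length ps = n \<and> length qs = n \<and> (\<forall>p\<in>set ps. p > (0::real)) \<and>
    char_poly G = (\<Prod>e\<leftarrow>map complex_of_real (ps @ qs). [:- e, 1:])"
proof -
  let ?N = "2 * n"
  obtain es where es: "char_poly G = (\<Prod>e\<leftarrow>es. [:- e, 1:])" "length es = ?N"
    using char_poly_factorized[OF G(1)] by blast
  obtain V where V: "unitary ?N V" and GV: "G * V = V * mat_diag ?N (\<lambda>i. es ! i)"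
    using hermitian_diagonalization[OF G es(1)] by blast
  define r where "r i = Re (es ! i)" for i
  have er: "es ! i = complex_of_real (r i)" if "i < ?N" for i
    using hermitian_eigenvalues_real[OF G V GV that] unfolding r_def
    by (metis Reals_cnj_iff of_real_Re)
  define D where "D = mat_diag ?N (\<lambda>i. complex_of_real (r i))"
  have GV: "G * V = V * D"
    unfolding GV D_def by (rule arg_cong[of _ _ "(*) V"], rule eq_matI) (auto simp: er)
  note [simp] = G(1) unitary_carrier[OF V] carrier_matD[OF unitary_carrier[OF V]] carrier_matD[OF G(1)]
    carrier_matD[OF J_mat_carrier] mult_carrier_mat[of _ ?N ?N _ ?N]
  note assoc = assoc_mult_mat[of _ ?N ?N _ ?N _ ?N]
  have Dc[simp]: "D \<in> carrier_mat ?N ?N" "dim_row D = ?N" "dim_col D = ?N" by (simp_all add: D_def)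
  define K where "K = J_mat n * map_mat cnj G * J_mat n"
  have Kc[simp]: "K \<in> carrier_mat ?N ?N" by (simp add: K_def)
  have "G * K = (G * J_mat n * map_mat cnj G) * J_mat n" by (simp add: K_def assoc)
  then have "G * K = 1\<^sub>m ?N" unfolding GJG by (simp add: J_mat_square)
  then have KG: "K * G = 1\<^sub>m ?N" by (rule mat_mult_left_right_inverse[rotated 2]) auto
  have KVD: "K * V * D = V"
  proof -
    have "K * V * D = (K * G) * V" by (simp add: assoc GV)
    then show ?thesis unfolding KG by simp
  qed
  \<comment> \<open>The diagonal entries of \<open>mat_adjoint V * K * V * D\<close> are 1, and the
    right factor D contributes the factor \<open>r i\<close> to the i-th of them.\<close>
  have r0: "r i \<noteq> 0" if "i < ?N" for i
  proof -
    have "(mat_adjoint V * K * V) * D = mat_adjoint V * (K * V * D)" by (simp add: assoc)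
    then have "((mat_adjoint V * K * V) * D) $$ (i, i) = 1"
      unfolding KVD unitary_left_inv[OF V] using that by simp
    then show ?thesis
      unfolding D_def by (subst (asm) mat_diag_mult_right[of _ ?N]) (use that in auto)
  qed
  have "K * V = V * mat_diag ?N (\<lambda>i. complex_of_real (1 / r i))" (is "_ = V * ?D'")
  proof -
    have "D * ?D' = 1\<^sub>m ?N"
      unfolding D_def mat_diag_diag by (rule eq_matI) (auto simp: r0)
    moreover have "K * V * D * ?D' = K * V * (D * ?D')" by (simp add: assoc)
    ultimately show ?thesis unfolding KVD by (simp add: right_mult_one_mat[of _ ?N ?N])
  qed
  then have c1: "char_poly K = (\<Prod>e\<leftarrow>map (\<lambda>i. complex_of_real (1 / r i)) [0..<?N]. [:- e, 1:])"
    by (rule char_poly_unitary_diag[OF Kc V])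
  \<comment> \<open>A second diagonalization of K: V already gives the eigenvalues
    \<open>1 / r i\<close>, while the images of the columns of V under v -> J cnj v give
    \<open>- r i\<close>.\<close>
  define V' where "V' = J_mat n * map_mat cnj V"
  have V'c[simp]: "V' \<in> carrier_mat ?N ?N" by (simp add: V'_def)
  have V': "unitary ?N V'"
  proof -
    have "mat_adjoint (map_mat cnj V) * map_mat cnj V = map_mat cnj (mat_adjoint V * V)"
      by (simp add: mat_cnj_mult[of _ ?N ?N _ ?N])
        (intro arg_cong[of _ _ "\<lambda>X. X * map_mat cnj V"] eq_matI; simp)
    also have "\<dots> = 1\<^sub>m ?N" unfolding unitary_left_inv[OF V] by (rule eq_matI) auto
    finally have "unitary ?N (map_mat cnj V)" by (simp add: unitary_def)
    moreover have "unitary ?N (J_mat n)"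
      by (simp add: unitary_def J_mat_adjoint J_mat_square)
    ultimately show ?thesis unfolding V'_def by (intro unitary_mult)
  qed
  have "K * V' = - (J_mat n * map_mat cnj (G * V))"
    by (simp add: K_def V'_def assoc J_mat_J_mat_mult[of _ _ ?N] mat_cnj_mult[of _ ?N ?N _ ?N])
  also have "\<dots> = - (V' * D)"
  proof -
    have "map_mat cnj D = D" by (rule eq_matI) (auto simp: D_def)
    then show ?thesis by (simp add: GV V'_def mat_cnj_mult[of _ ?N ?N _ ?N] assoc)
  qed
  also have "\<dots> = V' * mat_diag ?N (\<lambda>i. complex_of_real (- r i))"
  proof -
    have "mat_diag ?N (\<lambda>i. complex_of_real (- r i)) = - D" by (rule eq_matI) (auto simp: D_def)
    then show ?thesis using carrier_matD[OF V'c] by simp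
  qed
  finally have "char_poly K = (\<Prod>e\<leftarrow>map (\<lambda>i. complex_of_real (- r i)) [0..<?N]. [:- e, 1:])"
    by (rule char_poly_unitary_diag[OF Kc V'])
  with c1 have "mset (map (\<lambda>i. complex_of_real (1 / r i)) [0..<?N]) =
      mset (map (\<lambda>i. complex_of_real (- r i)) [0..<?N])"
    by (intro mset_roots_unique) (simp only:)
  from arg_cong[OF this, of "image_mset Re"]
  have "mset (map (\<lambda>i. 1 / r i) [0..<?N]) = mset (map (\<lambda>i. - r i) [0..<?N])"
    by (simp add: multiset.map_comp comp_def del: of_real_minus of_real_divide)
  \<comment> \<open>\<open>1 / r i\<close> has the sign of \<open>r i\<close>, so counting positive
    members on both sides shows that as many \<open>r i\<close> are positive as negative.\<close>
  from arg_cong[OF this, of "\<lambda>M. size (filter_mset (\<lambda>x. x > 0) M)"]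
  have *: "length (filter (\<lambda>x. x > 0) (map (\<lambda>i. 1 / r i) [0..<?N])) =
      length (filter (\<lambda>x. x > 0) (map (\<lambda>i. - r i) [0..<?N]))"
    by (metis mset_filter size_mset)
  have "filter (\<lambda>i. - r i > 0) [0..<?N] = filter (\<lambda>i. \<not> r i > 0) [0..<?N]"
    by (rule filter_cong) (use r0 in \<open>force simp: not_less less_le\<close>)+
  with * have cnt: "length (filter (\<lambda>i. r i > 0) [0..<?N]) = length (filter (\<lambda>i. \<not> r i > 0) [0..<?N])"
    by (simp add: filter_map comp_def)
  define ps where "ps = map r (filter (\<lambda>i. r i > 0) [0..<?N])"
  define qs where "qs = map r (filter (\<lambda>i. \<not> r i > 0) [0..<?N])"
  have "length ps + length qs = ?N"
    using sum_length_filter_compl[of "\<lambda>i. r i > 0" "[0..<?N]"] by (simp add: ps_def qs_def)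
  then have "length ps = n" "length qs = n"
    using cnt by (simp_all add: ps_def qs_def)
  moreover have "\<forall>p\<in>set ps. p > 0" by (auto simp: ps_def)
  moreover have "char_poly G = (\<Prod>e\<leftarrow>map complex_of_real (ps @ qs). [:- e, 1:])"
  proof -
    have "es = map (\<lambda>i. complex_of_real (r i)) [0..<?N]"
      by (rule nth_equalityI) (auto simp: es er)
    then have "mset es = image_mset complex_of_real (image_mset r (mset [0..<?N]))"
      by (simp add: multiset.map_comp comp_def)
    also have "mset [0..<?N] = mset (filter (\<lambda>i. r i > 0) [0..<?N]) + mset (filter (\<lambda>i. \<not> r i > 0) [0..<?N])"
      by (metis mset_filter multiset_partition)
    also have "image_mset complex_of_real (image_mset r \<dots>) = mset (map complex_of_real (ps @ qs))"
      by (simp add: ps_def qs_def multiset.map_comp)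
    finally show ?thesis unfolding es(1) by (rule prod_list_map_mset)
  qed
  ultimately show ?thesis by blast
qed

text \<open>The juxtaposition [A B], encoded with a lower block row of height 0 so that the
  multiplication rule for \<open>four_block_mat\<close> applies to it.\<close>

definition hcat :: "complex mat \<Rightarrow> complex mat \<Rightarrow> complex mat" where
  "hcat A B = four_block_mat A B (0\<^sub>m 0 (dim_col A)) (0\<^sub>m 0 (dim_col B))"

lemma hcat_carrier[simp]:
  "A \<in> carrier_mat m k \<Longrightarrow> B \<in> carrier_mat m l \<Longrightarrow> hcat A B \<in> carrier_mat m (k + l)"
  by (rule carrier_matI) (auto simp: hcat_def)

lemma mult_hcat:
  assumes "M \<in> carrier_mat k m" "A \<in> carrier_mat m n" "B \<in> carrier_mat m l"
  shows "M * hcat A B = hcat (M * A) (M * B)"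
  by (rule eq_matI) (use assms in \<open>auto simp: hcat_def scalar_prod_def\<close>)

lemma hcat_cnj: "dim_row A = dim_row B \<Longrightarrow> map_mat cnj (hcat A B) = hcat (map_mat cnj A) (map_mat cnj B)"
  by (rule eq_matI) (auto simp: hcat_def)

lemma hcat_mult_diag_blocks:
  assumes A: "A \<in> carrier_mat m n" and B: "B \<in> carrier_mat m n"
  shows "hcat A B * diag_blocks n a b c d =
    hcat (A * mat_diag n a + B * mat_diag n c) (A * mat_diag n b + B * mat_diag n d)"
proof -
  have "dim_col A = n" "dim_col B = n" using A B by auto
  then show ?thesis
    unfolding hcat_def diag_blocks_def
    using A B
    by (subst mult_four_block_mat[of _ m n _ n _ 0 _ _ n _ n])
      (auto simp: left_mult_zero_mat[of "mat_diag n f" n n for f])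
qed

lemma hcat_gram:
  assumes A: "A \<in> carrier_mat m n" and B: "B \<in> carrier_mat m n"
  shows "mat_adjoint (hcat A B) * hcat A B =
    four_block_mat (mat_adjoint A * A) (mat_adjoint A * B) (mat_adjoint B * A) (mat_adjoint B * B)"
  by (rule eq_matI) (use A B in \<open>auto simp: hcat_def scalar_prod_def\<close>)

lemma mat_cnj_adjoint_mult:
  assumes "A \<in> carrier_mat m n" "B \<in> carrier_mat m k"
  shows "mat_adjoint (map_mat cnj A) * map_mat cnj B = map_mat cnj (mat_adjoint A * B)"
  by (rule eq_matI) (use assms in \<open>auto simp: scalar_prod_def\<close>)

text \<open>The spectral theorem supplies a full eigenbasis, but only its positive half L is kept;
  the negative half is rebuilt as W from L. Then Q = [L W] intertwines J with v -> J cnj v by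
  construction, and \<open>symplectic_if_quaternionic\<close> applies once Q is known to be
  unitary.\<close>

lemma quaternionic_diagonalization:
  fixes G :: "complex mat"
  assumes G: "G \<in> carrier_mat (2 * n) (2 * n)" "mat_adjoint G = G"
    and GJG: "G * J_mat n * map_mat cnj G = - J_mat n"
  shows "\<exists>Q l. unitary (2 * n) Q \<and> symplectic n Q \<and> (\<forall>i<n. l i > (0::real)) \<and>
    G * Q = Q * diag_blocks n (\<lambda>i. of_real (l i)) (\<lambda>_. 0) (\<lambda>_. 0) (\<lambda>i. - 1 / of_real (l i))"
proof -
  let ?N = "2 * n"
  obtain ps qs where len: "length ps = n" "length qs = n" and pos: "\<forall>p\<in>set ps. p > (0::real)"
    and cp: "char_poly G = (\<Prod>e\<leftarrow>map complex_of_real (ps @ qs). [:- e, 1:])"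
    using quaternionic_spectrum[OF G GJG] by blast
  obtain V where V: "unitary ?N V"
    and GV: "G * V = V * mat_diag ?N (\<lambda>i. map complex_of_real (ps @ qs) ! i)"
    using hermitian_diagonalization[OF G cp] by blast
  define l where "l i = ps ! i" for i
  have l: "l i > 0" if "i < n" for i using pos len that by (auto simp: l_def)
  note Vc = unitary_carrier[OF V]
  define D where "D = mat_diag n (\<lambda>i. complex_of_real (l i))"
  define D' where "D' = mat_diag n (\<lambda>i. - (1 / complex_of_real (l i)))"
  have DD': "D * D' = - 1\<^sub>m n"
    unfolding D_def D'_def mat_diag_diag
    by (rule eq_matI) (use l in \<open>auto simp: less_imp_neq[symmetric]\<close>)
  \<comment> \<open>The list of eigenvalues starts with the n positive ones, so the first n columns
    of V belong to them.\<close>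
  define L where "L = mat ?N n (\<lambda>(i,j). V $$ (i,j))"
  \<comment> \<open>The minus sign is the one for which J cnj [L W] = [-W L] = [L W] J.\<close>
  define W where "W = - (J_mat n * map_mat cnj L)"
  have [simp]: "D \<in> carrier_mat n n" "D' \<in> carrier_mat n n" "L \<in> carrier_mat ?N n" "G \<in> carrier_mat ?N ?N"
    by (simp_all add: D_def D'_def L_def G)
  then have [simp]: "W \<in> carrier_mat ?N n"
    by (simp add: W_def mult_carrier_mat[of _ ?N ?N _ n])
  note [simp] = J_mat_carrier mult_carrier_mat[of _ ?N ?N _ ?N] mult_carrier_mat[of _ ?N ?N _ n]
    mult_carrier_mat[of _ ?N n _ n] mult_carrier_mat[of _ n ?N _ n]
  note [simp] = carrier_matD[OF \<open>L \<in> carrier_mat ?N n\<close>] carrier_matD[OF \<open>W \<in> carrier_mat ?N n\<close>]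
    carrier_matD[OF \<open>D \<in> carrier_mat n n\<close>] carrier_matD[OF \<open>D' \<in> carrier_mat n n\<close>]
    carrier_matD[OF G(1)] carrier_matD[OF J_mat_carrier]
  have GL: "G * L = L * D"
  proof (rule eq_matI)
    fix i j assume "i < dim_row (L * D)" "j < dim_col (L * D)"
    then have ij: "i < ?N" "j < n" by simp_all
    have "(G * L) $$ (i,j) = (G * V) $$ (i,j)"
      using ij Vc by (auto simp: L_def scalar_prod_def)
    also have "\<dots> = V $$ (i,j) * complex_of_real (l j)"
      unfolding GV using ij len
      by (subst mat_diag_mult_right[OF Vc]) (simp add: l_def nth_append)
    also have "\<dots> = (L * D) $$ (i,j)"
      unfolding D_def using ij by (subst mat_diag_mult_right[of _ ?N]) (simp_all add: L_def)
    finally show "(G * L) $$ (i,j) = (L * D) $$ (i,j)" .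
  qed simp_all
  have LL: "mat_adjoint L * L = 1\<^sub>m n"
  proof (rule eq_matI)
    fix i j assume "i < dim_row (1\<^sub>m n)" "j < dim_col (1\<^sub>m n)"
    then have ij: "i < n" "j < n" by simp_all
    have "(mat_adjoint L * L) $$ (i,j) = (mat_adjoint V * V) $$ (i,j)"
      using ij Vc by (auto simp: L_def scalar_prod_def)
    then show "(mat_adjoint L * L) $$ (i,j) = 1\<^sub>m n $$ (i,j)"
      using ij by (simp add: unitary_left_inv[OF V])
  qed simp_all
  have cD: "map_mat cnj D = D" "mat_adjoint D = D" by (rule eq_matI; simp add: D_def)+
  have GW: "G * W = W * D'"
  proof -
    \<comment> \<open>The extra factor D lets \<open>L * D\<close> be replaced by
      \<open>G * L\<close>, which exposes the product \<open>G * J_mat n * map_mat cnj G\<close>; D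
      is then removed by \<open>D * D' = - 1\<close>.\<close>
    have "G * W * D = - (G * (J_mat n * map_mat cnj (L * D)))"
      by (simp add: W_def assoc_mult_mat[of _ ?N ?N _ n _ n] assoc_mult_mat[of _ ?N ?N _ ?N _ n]
          mat_cnj_mult[of _ ?N n _ n] cD)
    also have "\<dots> = - ((G * J_mat n * map_mat cnj G) * map_mat cnj L)"
      by (simp add: assoc_mult_mat[of _ ?N ?N _ ?N _ n] flip: GL)
        (simp add: mat_cnj_mult[of _ ?N ?N _ n])
    also have "\<dots> = - W" unfolding GJG by (simp add: W_def)
    finally have "G * W * D * D' = - W * D'" by simp
    moreover have "G * W * D * D' = - (G * W)"
      by (simp add: assoc_mult_mat[of _ ?N n _ n _ n] DD' right_mult_one_mat[of _ ?N n])
    ultimately have "- (- (G * W)) = - (- (W * D'))" by simp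
    then show ?thesis by (simp only: uminus_uminus_mat)
  qed
  have WW: "mat_adjoint W * W = 1\<^sub>m n"
  proof -
    have "mat_adjoint W = mat_adjoint (map_mat cnj L) * J_mat n"
    proof -
      have "mat_adjoint (- A) = - mat_adjoint A" for A :: "complex mat"
        by (rule eq_matI) auto
      then show ?thesis
        by (simp add: W_def mat_adjoint_mult[of _ ?N ?N _ n] J_mat_adjoint)
    qed
    then have "mat_adjoint W * W = mat_adjoint (map_mat cnj L) * map_mat cnj L"
      by (simp add: W_def assoc_mult_mat[of _ n ?N _ ?N _ n] J_mat_J_mat_mult[of _ _ n])
    also have "\<dots> = 1\<^sub>m n"
      unfolding mat_cnj_adjoint_mult[OF \<open>L \<in> carrier_mat ?N n\<close> \<open>L \<in> carrier_mat ?N n\<close>] LL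
      by (rule eq_matI) auto
    finally show ?thesis .
  qed
  have LW: "mat_adjoint L * W = 0\<^sub>m n n"
  proof -
    define X where "X = mat_adjoint L * W"
    have X[simp]: "X \<in> carrier_mat n n" by (simp add: X_def)
    \<comment> \<open>Moving G from L to W gives \<open>(l i + 1 / l j) * X $$ (i, j) = 0\<close>.
      The coefficient is positive whether or not the \<open>l i\<close> are distinct, so L and W are
      orthogonal even for repeated eigenvalues.\<close>
    have "D * X = mat_adjoint (G * L) * W"
      unfolding GL X_def
      by (simp add: mat_adjoint_mult[of _ ?N n _ n] cD assoc_mult_mat[of _ n n _ ?N _ n])
    also have "\<dots> = X * D'"
      using GW by (simp add: X_def mat_adjoint_mult[of _ ?N ?N _ n] G(2)
          assoc_mult_mat[of _ n ?N _ n _ n] assoc_mult_mat[of _ n ?N _ ?N _ n])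
    finally have DX: "D * X = X * D'" .
    show ?thesis unfolding X_def[symmetric]
    proof (rule eq_matI)
      fix i j assume "i < dim_row (0\<^sub>m n n)" "j < dim_col (0\<^sub>m n n)"
      then have ij: "i < n" "j < n" by simp_all
      have "(D * X) $$ (i,j) = complex_of_real (l i) * X $$ (i,j)"
        unfolding D_def using ij by (subst mat_diag_mult_left[OF X]) simp
      moreover have "(X * D') $$ (i,j) = X $$ (i,j) * (- 1 / complex_of_real (l j))"
        unfolding D'_def using ij by (subst mat_diag_mult_right[OF X]) simp
      ultimately have "complex_of_real (l i) * X $$ (i,j) = - (X $$ (i,j) / complex_of_real (l j))"
        unfolding DX by simp
      then have "complex_of_real (l i + 1 / l j) * X $$ (i,j) = 0"
        by (simp add: ring_distribs)
      moreover have "l i + 1 / l j > 0" using l ij by (simp add: add_pos_pos)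
      ultimately show "X $$ (i,j) = 0\<^sub>m n n $$ (i,j)"
        using ij by (metis index_zero_mat(1) less_irrefl mult_eq_0_iff of_real_eq_0_iff)
    qed (simp_all add: X_def)
  qed
  have WL: "mat_adjoint W * L = 0\<^sub>m n n"
  proof -
    have "mat_adjoint W * L = mat_adjoint (mat_adjoint L * W)"
      by (simp add: mat_adjoint_mult[of _ n ?N _ n])
    also have "\<dots> = 0\<^sub>m n n" unfolding LW by (rule eq_matI) auto
    finally show ?thesis .
  qed
  define Q where "Q = hcat L W"
  have "Q \<in> carrier_mat ?N (n + n)"
    unfolding Q_def by (rule hcat_carrier) simp_all
  moreover have "mat_adjoint Q * Q = 1\<^sub>m (n + n)"
    unfolding Q_def by (subst hcat_gram[of _ ?N n]) (simp_all add: LL WW LW WL)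
  ultimately have Q: "unitary ?N Q"
    by (simp add: unitary_def flip: mult_2)
  moreover have "symplectic n Q"
  proof (rule symplectic_if_quaternionic[OF Q])
    have JL: "J_mat n * map_mat cnj L = - W"
      by (simp add: W_def)
    have "map_mat cnj W = - (J_mat n * L)"
    proof -
      have "map_mat cnj (- A) = - map_mat cnj A" "map_mat cnj (map_mat cnj A) = A" for A
        by (rule eq_matI; simp)+
      then show ?thesis
        by (simp add: W_def mat_cnj_mult[of _ ?N ?N _ n] J_mat_cnj)
    qed
    then have JW: "J_mat n * map_mat cnj W = L"
      by (simp add: J_mat_J_mat_mult[of _ _ n])
    have z: "mat_diag n (\<lambda>_. 0) = (0\<^sub>m n n :: complex mat)" "mat_diag n (\<lambda>_. - 1) = - (1\<^sub>m n :: complex mat)"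
      by (rule eq_matI; simp)+
    have "Q * J_mat n = hcat (- W) L"
      unfolding Q_def J_mat_diag_blocks
      by (subst hcat_mult_diag_blocks[of _ ?N])
        (simp_all add: z right_mult_zero_mat[of _ ?N n] right_mult_one_mat[of _ ?N n]
          left_add_zero_mat[of _ ?N n] right_add_zero_mat[of _ ?N n])
    then show "J_mat n * map_mat cnj Q = Q * J_mat n"
      by (simp add: Q_def hcat_cnj mult_hcat[of _ ?N ?N _ n _ n] JL JW)
  qed
  moreover have "G * Q = Q * diag_blocks n (\<lambda>i. of_real (l i)) (\<lambda>_. 0) (\<lambda>_. 0) (\<lambda>i. - 1 / of_real (l i))"
  proof -
    have z: "mat_diag n (\<lambda>_. 0) = (0\<^sub>m n n :: complex mat)"
      by (rule eq_matI; simp)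
    show ?thesis
      unfolding Q_def
      by (subst hcat_mult_diag_blocks[of _ ?N])
        (simp_all add: mult_hcat[of _ ?N ?N _ n _ n] GL GW z right_mult_zero_mat[of _ ?N n]
          left_add_zero_mat[of _ ?N n] right_add_zero_mat[of _ ?N n] flip: D_def D'_def)
  qed
  ultimately show ?thesis using Q l by blast
qed

section \<open>The decomposition\<close>

text \<open>J is real and skew-symmetric; the factor i turns it into a Hermitian involution, and
  congruence by S then yields a Hermitian matrix.\<close>

definition iJ_mat :: "nat \<Rightarrow> complex mat" where
  "iJ_mat n = \<i> \<cdot>\<^sub>m J_mat n"

lemma iJ_mat_diag_blocks: "iJ_mat n = diag_blocks n (\<lambda>_. 0) (\<lambda>_. \<i>) (\<lambda>_. - \<i>) (\<lambda>_. 0)"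
  by (simp add: iJ_mat_def J_mat_diag_blocks diag_blocks_smult)

lemma iJ_mat_carrier[simp]: "iJ_mat n \<in> carrier_mat (2 * n) (2 * n)"
  by (simp add: iJ_mat_diag_blocks)

lemma iJ_mat_adjoint: "mat_adjoint (iJ_mat n) = iJ_mat n"
  by (simp add: iJ_mat_diag_blocks diag_blocks_adjoint)

lemma iJ_mat_square: "iJ_mat n * iJ_mat n = 1\<^sub>m (2 * n)"
  by (simp add: iJ_mat_diag_blocks diag_blocks_mult one_mat_diag_blocks)

text \<open>This is the relation G J cnj G = -J for the identity in place of S;
  \<open>hermitian_form_properties\<close> reduces the general case to it.\<close>

lemma iJ_mat_J_mat_cnj: "iJ_mat n * (J_mat n * map_mat cnj (iJ_mat n)) = - J_mat n"
  by (simp add: iJ_mat_diag_blocks J_mat_diag_blocks diag_blocks_map diag_blocks_mult diag_blocks_uminus)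

lemma symplectic_iJ_right:
  assumes "symplectic n S"
  shows "S * iJ_mat n * transpose_mat S = iJ_mat n"
proof -
  note [simp] = symplectic_carrier[OF assms] mult_carrier_mat[of _ "2*n" "2*n" _ "2*n"]
  have "S * iJ_mat n * transpose_mat S = \<i> \<cdot>\<^sub>m (S * J_mat n * transpose_mat S)"
    by (simp add: iJ_mat_def mult_smult_distrib[of _ "2*n" "2*n" _ "2*n"]
        mult_smult_assoc_mat[of _ "2*n" "2*n" _ "2*n"] del: assoc_mult_mat)
  then show ?thesis by (simp add: symplectic_right[OF assms] iJ_mat_def)
qed

lemma mat_of_real_mult:
  "A \<in> carrier_mat m n \<Longrightarrow> B \<in> carrier_mat n k \<Longrightarrow>
    map_mat complex_of_real (A * B) = map_mat complex_of_real A * map_mat complex_of_real B"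
  by (rule eq_matI) (auto simp: scalar_prod_def)

text \<open>\<open>map_mat Re\<close> undoes the embedding, so an identity between real matrices may
  be checked after passing to complex entries.\<close>

lemma symplectic_of_real:
  "symplectic n (map_mat complex_of_real Y) \<longleftrightarrow> symplectic n Y"
proof (cases "Y \<in> carrier_mat (2 * n) (2 * n)")
  case True
  note [simp] = True mult_carrier_mat[of _ "2*n" "2*n" _ "2*n"]
  have Re: "map_mat Re (map_mat complex_of_real A) = A" for A
    by (rule eq_matI) auto
  have "transpose_mat (map_mat complex_of_real Y) * J_mat n * map_mat complex_of_real Y =
      map_mat complex_of_real (transpose_mat Y * J_mat n * Y)"
    unfolding map_mat_transpose
    by (simp add: mat_of_real_mult[of _ "2*n" "2*n" _ "2*n"] J_mat_of_real)
  moreover have "map_mat complex_of_real (transpose_mat Y * J_mat n * Y) = J_mat n \<longleftrightarrow>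
      transpose_mat Y * J_mat n * Y = J_mat n"
    using Re[of "transpose_mat Y * J_mat n * Y"] Re[of "J_mat n"] J_mat_of_real[of n] by metis
  ultimately show ?thesis by (simp add: symplectic_def)
qed (simp add: symplectic_def)

lemma symplectic_real_iJ:
  assumes "symplectic n Y"
  shows "map_mat complex_of_real Y * iJ_mat n * mat_adjoint (map_mat complex_of_real Y) = iJ_mat n"
proof -
  have "mat_adjoint (map_mat complex_of_real Y) = transpose_mat (map_mat complex_of_real Y)"
    by (rule eq_matI) auto
  then show ?thesis
    using assms by (simp only: symplectic_iJ_right symplectic_of_real)
qed

text \<open>Conversely, \<open>Y iJ Y\<^sup>* = iJ = Y iJ Y\<^sup>T\<close> forces \<open>Y\<^sup>* = Y\<^sup>T\<close>.\<close>

lemma symplectic_iJ_real: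
  assumes Y: "symplectic n Y" and iJ: "Y * iJ_mat n * mat_adjoint Y = iJ_mat n"
  shows "\<exists>Y'. symplectic n Y' \<and> Y = map_mat complex_of_real Y'"
proof -
  note [simp] = symplectic_carrier[OF Y] mult_carrier_mat[of _ "2*n" "2*n" _ "2*n"]
    carrier_matD[OF symplectic_carrier[OF Y]] carrier_matD[OF J_mat_carrier]
  note assoc = assoc_mult_mat[of _ "2*n" "2*n" _ "2*n" _ "2*n"]
  \<comment> \<open>The inverse of Y, read off its symplectic relation; \<open>canc\<close> uses it
    to cancel the left factor \<open>Y * iJ_mat n\<close> common to the two expressions for
    iJ.\<close>
  define Z where "Z = - (J_mat n * (transpose_mat Y * J_mat n))"
  have [simp]: "Z \<in> carrier_mat (2*n) (2*n)" by (simp add: Z_def)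
  have "Z * Y = - (J_mat n * (transpose_mat Y * J_mat n * Y))"
    by (simp add: Z_def assoc)
  also have "\<dots> = 1\<^sub>m (2 * n)" using Y by (simp add: symplectic_def J_mat_square)
  finally have ZY: "Z * Y = 1\<^sub>m (2 * n)" .
  have canc: "iJ_mat n * (Z * (Y * iJ_mat n * X)) = X" if [simp]: "X \<in> carrier_mat (2*n) (2*n)" for X
  proof -
    have "iJ_mat n * (Z * (Y * iJ_mat n * X)) = iJ_mat n * ((Z * Y) * (iJ_mat n * X))"
      by (simp add: assoc)
    also have "\<dots> = (iJ_mat n * iJ_mat n) * X"
      unfolding ZY by (simp add: assoc left_mult_one_mat[of _ "2*n" "2*n"])
    finally show ?thesis by (simp add: iJ_mat_square left_mult_one_mat[of _ "2*n" "2*n"])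
  qed
  have "mat_adjoint Y = transpose_mat Y"
    using canc[of "mat_adjoint Y"] canc[of "transpose_mat Y"] iJ symplectic_iJ_right[OF Y] by simp
  then have "map_mat cnj Y = Y"
    unfolding mat_adjoint_conv by (metis transpose_transpose)
  have real: "complex_of_real (Re (Y $$ (i,j))) = Y $$ (i,j)" if "i < 2 * n" "j < 2 * n" for i j
    using arg_cong[OF \<open>map_mat cnj Y = Y\<close>, of "\<lambda>X. X $$ (i,j)"] that
    by (simp add: complex_eq_iff)
  have "Y = map_mat complex_of_real (map_mat Re Y)"
    by (rule eq_matI) (simp_all add: real)
  then show ?thesis using Y symplectic_of_real by metis
qed

section \<open>The hyperbolic factor and its diagonalization\<close>

lemma hyperbolic_mat_carrier[simp]: "hyperbolic_mat n \<theta> \<in> carrier_mat (2 * n) (2 * n)"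
  by (simp add: hyperbolic_mat_diag_blocks)

lemma hyperbolic_mat_adjoint: "mat_adjoint (hyperbolic_mat n \<theta>) = hyperbolic_mat n \<theta>"
  by (simp add: hyperbolic_mat_diag_blocks diag_blocks_adjoint)

lemma cosh_sq_minus_sinh_sq_complex:
  "complex_of_real (cosh t) * complex_of_real (cosh t) - complex_of_real (sinh t) * complex_of_real (sinh t) = 1"
proof -
  have "cosh t * cosh t - sinh t * sinh t = 1"
    using hyperbolic_pythagoras[of t] by (simp add: power2_eq_square)
  from arg_cong[OF this, of complex_of_real] show ?thesis by simp
qed

lemma hyperbolic_mat_inverse: "hyperbolic_mat n \<theta> * hyperbolic_mat n (\<lambda>i. - \<theta> i) = 1\<^sub>m (2 * n)"
  unfolding hyperbolic_mat_diag_blocks diag_blocks_mult one_mat_diag_blocks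
  by (rule diag_blocks_cong) (simp add: algebra_simps cosh_sq_minus_sinh_sq_complex)

lemma hyperbolic_mat_symplectic: "symplectic n (hyperbolic_mat n \<theta>)"
proof -
  have "transpose_mat (hyperbolic_mat n \<theta>) * J_mat n * hyperbolic_mat n \<theta> = J_mat n"
    unfolding hyperbolic_mat_diag_blocks J_mat_diag_blocks diag_blocks_mult diag_blocks_transpose
    by (rule diag_blocks_cong) (use cosh_sq_minus_sinh_sq_complex in \<open>auto simp: algebra_simps\<close>)
  then show ?thesis by (simp add: symplectic_def)
qed

text \<open>For each index the columns are (1, -i) and (-i, 1), scaled to length 1: the eigenvectors
  of the 2 x 2 block of i H J H, whatever \<theta> is. Their phases are chosen so that the second is
  the image of the first under v -> -J cnj v, which makes the matrix symplectic as well as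
  unitary.\<close>

definition rot_mat :: "nat \<Rightarrow> complex mat" where
  "rot_mat n = (let a = complex_of_real (1 / sqrt 2) in
     diag_blocks n (\<lambda>_. a) (\<lambda>_. - \<i> * a) (\<lambda>_. - \<i> * a) (\<lambda>_. a))"

lemma inv_sqrt2_square: "complex_of_real (1 / sqrt 2) * complex_of_real (1 / sqrt 2) = 1 / 2"
  by (simp flip: of_real_mult)

lemma rot_mat_unitary: "unitary (2 * n) (rot_mat n)"
proof -
  define a where "a = complex_of_real (1 / sqrt 2)"
  have a: "a * a = 1 / 2" "cnj a = a" unfolding a_def by (rule inv_sqrt2_square) simp
  then have "a * (a * x) = x / 2" for x by (simp flip: mult.assoc)
  then have "mat_adjoint (rot_mat n) * rot_mat n = 1\<^sub>m (2 * n)"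
    unfolding rot_mat_def a_def[symmetric] Let_def diag_blocks_adjoint diag_blocks_mult one_mat_diag_blocks
    by (intro diag_blocks_cong) (simp add: a algebra_simps)
  then show ?thesis by (simp add: unitary_def rot_mat_def Let_def)
qed

lemma rot_mat_symplectic: "symplectic n (rot_mat n)"
proof (rule symplectic_if_quaternionic[OF rot_mat_unitary])
  show "J_mat n * map_mat cnj (rot_mat n) = rot_mat n * J_mat n"
    by (simp add: rot_mat_def Let_def J_mat_diag_blocks diag_blocks_map diag_blocks_mult)
qed

definition hyperbolic_eigenvalue :: "nat \<Rightarrow> (nat \<Rightarrow> real) \<Rightarrow> nat \<Rightarrow> real" where
  "hyperbolic_eigenvalue n \<theta> i = (if i < n then exp (2 * \<theta> i) else - exp (- 2 * \<theta> (i - n)))"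

lemma hyperbolic_mat_iJ:
  "hyperbolic_mat n \<theta> * iJ_mat n * hyperbolic_mat n \<theta> =
    rot_mat n * mat_diag (2 * n) (\<lambda>i. complex_of_real (hyperbolic_eigenvalue n \<theta> i)) * mat_adjoint (rot_mat n)"
proof -
  have e: "complex_of_real (exp (2 * t)) = (complex_of_real (cosh t) + complex_of_real (sinh t))\<^sup>2"
    "complex_of_real (exp (- 2 * t)) = (complex_of_real (cosh t) - complex_of_real (sinh t))\<^sup>2" for t
    using cosh_plus_sinh[of t] cosh_minus_sinh[of t]
    by (simp_all flip: of_real_add of_real_diff of_real_power add: exp_double[of "- t", simplified] exp_double)
  have ev: "hyperbolic_eigenvalue n \<theta> i = exp (2 * \<theta> i)"
    "hyperbolic_eigenvalue n \<theta> (i + n) = - exp (- 2 * \<theta> i)" if "i < n" for i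
    using that by (simp_all add: hyperbolic_eigenvalue_def)
  define a where "a = complex_of_real (1 / sqrt 2)"
  have a: "a * a = 1 / 2" "cnj a = a" unfolding a_def by (rule inv_sqrt2_square) simp
  have "hyperbolic_mat n \<theta> * iJ_mat n * hyperbolic_mat n \<theta> =
    (let c = \<lambda>i. complex_of_real (cosh (\<theta> i)); s = \<lambda>i. complex_of_real (sinh (\<theta> i)) in
     diag_blocks n (\<lambda>i. 2 * s i * c i) (\<lambda>i. \<i> * ((c i)\<^sup>2 + (s i)\<^sup>2)) (\<lambda>i. - \<i> * ((c i)\<^sup>2 + (s i)\<^sup>2))
       (\<lambda>i. 2 * s i * c i))"
    unfolding hyperbolic_mat_diag_blocks iJ_mat_diag_blocks diag_blocks_mult Let_def
    by (rule diag_blocks_cong) (simp add: algebra_simps power2_eq_square)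
  \<comment> \<open>With p and q the two eigenvalues of a block, 2 sinh cosh = (p + q) / 2 and
    cosh^2 + sinh^2 = (p - q) / 2. The factor 1/2 is written as \<open>a * a\<close> to match the
    entries of the product with \<open>rot_mat\<close>.\<close>
  also have "\<dots> = (let p = \<lambda>i. complex_of_real (exp (2 * \<theta> i)); q = \<lambda>i. - complex_of_real (exp (- 2 * \<theta> i)) in
     diag_blocks n (\<lambda>i. a * a * (p i + q i)) (\<lambda>i. \<i> * (a * a * (p i - q i)))
       (\<lambda>i. - \<i> * (a * a * (p i - q i))) (\<lambda>i. a * a * (p i + q i)))"
    unfolding a e Let_def by (rule diag_blocks_cong) (simp add: algebra_simps power2_eq_square)
  also have "\<dots> = rot_mat n * mat_diag (2 * n) (\<lambda>i. complex_of_real (hyperbolic_eigenvalue n \<theta> i)) * mat_adjoint (rot_mat n)"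
    unfolding rot_mat_def a_def[symmetric] Let_def diag_blocks_adjoint diag_blocks_mult mat_diag_diag_blocks
    by (rule diag_blocks_cong) (simp add: ev a(2) algebra_simps)
  finally show ?thesis .
qed

section \<open>Existence of the decomposition\<close>

text \<open>For the third claim, the conjugated symplectic relation of S collapses the middle of the
  product to J, the two copies of iJ around it leave -J, and \<open>symplectic_right\<close> removes
  the outer factors.\<close>

lemma hermitian_form_properties:
  assumes S: "symplectic n S"
  defines "G \<equiv> S * iJ_mat n * mat_adjoint S"
  shows "G \<in> carrier_mat (2 * n) (2 * n)" "mat_adjoint G = G" "G * J_mat n * map_mat cnj G = - J_mat n"
proof -
  note [simp] = symplectic_carrier[OF S] mult_carrier_mat[of _ "2*n" "2*n" _ "2*n"]
    carrier_matD[OF symplectic_carrier[OF S]] carrier_matD[OF J_mat_carrier]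
  note assoc = assoc_mult_mat[of _ "2*n" "2*n" _ "2*n" _ "2*n"]
  show "G \<in> carrier_mat (2 * n) (2 * n)" by (simp add: G_def)
  show "mat_adjoint G = G"
    by (simp add: G_def mat_adjoint_mult[of _ "2*n" "2*n" _ "2*n"] iJ_mat_adjoint assoc)
  have "map_mat cnj (mat_adjoint S) = transpose_mat S" by (rule eq_matI) auto
  then have "map_mat cnj G = map_mat cnj S * map_mat cnj (iJ_mat n) * transpose_mat S"
    by (simp add: G_def mat_cnj_mult[of _ "2*n" "2*n" _ "2*n"])
  then have "G * J_mat n * map_mat cnj G =
      S * (iJ_mat n * ((mat_adjoint S * J_mat n * map_mat cnj S) * map_mat cnj (iJ_mat n))) * transpose_mat S"
    by (simp add: G_def assoc)
  also have "mat_adjoint S * J_mat n * map_mat cnj S = J_mat n"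
    using symplectic_cnj[OF S] by (simp add: symplectic_def mat_adjoint_conv)
  also have "S * (iJ_mat n * (J_mat n * map_mat cnj (iJ_mat n))) * transpose_mat S = - (S * J_mat n * transpose_mat S)"
    unfolding iJ_mat_J_mat_cnj by simp
  finally show "G * J_mat n * map_mat cnj G = - J_mat n"
    by (simp only: symplectic_right[OF S])
qed

lemma decomposition_exists:
  assumes S: "symplectic n S"
  shows "\<exists>U Y \<theta>. unitary (2 * n) U \<and> symplectic n U \<and> symplectic n Y \<and>
    S = U * hyperbolic_mat n \<theta> * map_mat complex_of_real Y"
proof -
  let ?N = "2 * n"
  define G where "G = S * iJ_mat n * mat_adjoint S"
  note G = hermitian_form_properties[OF S, folded G_def]
  obtain Q l where Q: "unitary ?N Q" "symplectic n Q" and l: "\<forall>i<n. l i > (0::real)"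
    and GQ: "G * Q = Q * diag_blocks n (\<lambda>i. of_real (l i)) (\<lambda>_. 0) (\<lambda>_. 0) (\<lambda>i. - 1 / of_real (l i))"
    using quaternionic_diagonalization[OF G] by blast
  \<comment> \<open>Chosen so that exp (2 \<theta>) is the positive eigenvalue \<open>l i\<close>,
    and hence - exp (- 2 \<theta>) its partner \<open>- 1 / l i\<close>.\<close>
  define \<theta> where "\<theta> i = ln (l i) / 2" for i
  define E where "E = mat_diag ?N (\<lambda>i. complex_of_real (hyperbolic_eigenvalue n \<theta> i))"
  have "diag_blocks n (\<lambda>i. of_real (l i)) (\<lambda>_. 0) (\<lambda>_. 0) (\<lambda>i. - 1 / of_real (l i)) = E"
    unfolding E_def mat_diag_diag_blocks
    by (rule diag_blocks_cong) (use l in \<open>simp add: hyperbolic_eigenvalue_def \<theta>_def exp_minus inverse_eq_divide\<close>)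
  with GQ have GQ: "G * Q = Q * E" by simp
  define H where "H = hyperbolic_mat n \<theta>"
  define H' where "H' = hyperbolic_mat n (\<lambda>i. - \<theta> i)"
  \<comment> \<open>Q diagonalizes G and \<open>rot_mat n\<close> diagonalizes i H J H, both to the
    same matrix E; this product therefore conjugates one to the other.\<close>
  define U where "U = Q * mat_adjoint (rot_mat n)"
  have U: "unitary ?N U" "symplectic n U"
    unfolding U_def
    by (intro unitary_mult unitary_adjoint rot_mat_unitary Q symplectic_mult symplectic_adjoint rot_mat_symplectic)+
  note [simp] = symplectic_carrier[OF S] unitary_carrier[OF Q(1)] unitary_carrier[OF U(1)]
    unitary_carrier[OF rot_mat_unitary] mult_carrier_mat[of _ "2*n" "2*n" _ "2*n"] G(1)
  have [simp]: "H \<in> carrier_mat ?N ?N" "H' \<in> carrier_mat ?N ?N" "E \<in> carrier_mat ?N ?N"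
    by (simp_all add: H_def H'_def E_def)
  note assoc = assoc_mult_mat[of _ ?N ?N _ ?N _ ?N]
  have HH': "H * H' = 1\<^sub>m ?N" unfolding H_def H'_def by (rule hyperbolic_mat_inverse)
  then have H'H: "H' * H = 1\<^sub>m ?N" by (rule mat_mult_left_right_inverse[rotated 2]) auto
  have "mat_adjoint U * G * U = rot_mat n * (mat_adjoint Q * (G * Q)) * mat_adjoint (rot_mat n)"
    by (simp add: U_def mat_adjoint_mult[of _ ?N ?N _ ?N] assoc)
  also have "mat_adjoint Q * (G * Q) = (mat_adjoint Q * Q) * E"
    unfolding GQ by (simp add: assoc)
  also have "\<dots> = E" by (simp add: unitary_left_inv[OF Q(1)] left_mult_one_mat[of _ ?N ?N])
  also have "rot_mat n * E * mat_adjoint (rot_mat n) = H * iJ_mat n * H"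
    unfolding E_def H_def by (rule hyperbolic_mat_iJ[symmetric])
  finally have UGU: "mat_adjoint U * G * U = H * iJ_mat n * H" .
  define Y where "Y = H' * mat_adjoint U * S"
  have Yc[simp]: "Y \<in> carrier_mat ?N ?N" by (simp add: Y_def)
  have Y: "symplectic n Y"
    unfolding Y_def H'_def
    by (intro symplectic_mult hyperbolic_mat_symplectic symplectic_adjoint U S)
  have "mat_adjoint H' = H'" unfolding H'_def by (rule hyperbolic_mat_adjoint)
  then have "Y * iJ_mat n * mat_adjoint Y = H' * (mat_adjoint U * G * U) * H'"
    by (simp add: Y_def G_def mat_adjoint_mult[of _ ?N ?N _ ?N] assoc)
  also have "\<dots> = (H' * H) * iJ_mat n * (H * H')"
    unfolding UGU by (simp add: assoc)
  also have "\<dots> = iJ_mat n"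
    unfolding H'H HH' by (simp add: left_mult_one_mat[of _ ?N ?N] right_mult_one_mat[of _ ?N ?N])
  finally obtain Y' where Y': "symplectic n Y'" "Y = map_mat complex_of_real Y'"
    using symplectic_iJ_real[OF Y] by blast
  have "U * H * Y = U * (H * H') * mat_adjoint U * S"
    by (simp add: Y_def assoc)
  also have "\<dots> = S"
    unfolding HH' by (simp add: unitary_right_inv[OF U(1)] left_mult_one_mat[of _ ?N ?N] right_mult_one_mat[of _ ?N ?N])
  finally show ?thesis using U Y' unfolding H_def by metis
qed

section \<open>Uniqueness of the parameters\<close>

text \<open>The left side is determined by S alone and the right side by \<theta> alone, so any two
  decompositions of S share these eigenvalues. The diagonalizing matrix is U times the rotation,
  since Y is absorbed by iJ.\<close>

lemma decomposition_char_poly: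
  assumes U: "unitary (2 * n) U" and Y: "symplectic n Y"
    and S: "S = U * hyperbolic_mat n \<theta> * map_mat complex_of_real Y"
  shows "char_poly (S * iJ_mat n * mat_adjoint S) =
    (\<Prod>e\<leftarrow>map (\<lambda>i. complex_of_real (hyperbolic_eigenvalue n \<theta> i)) [0..<2 * n]. [:- e, 1:])"
proof -
  let ?N = "2 * n"
  define H where "H = hyperbolic_mat n \<theta>"
  define C where "C = map_mat complex_of_real Y"
  define R where "R = rot_mat n"
  define E where "E = mat_diag ?N (\<lambda>i. complex_of_real (hyperbolic_eigenvalue n \<theta> i))"
  have R: "unitary ?N R" unfolding R_def by (rule rot_mat_unitary)
  note [simp] = symplectic_carrier[OF Y] unitary_carrier[OF U] unitary_carrier[OF R]
    mult_carrier_mat[of _ "2*n" "2*n" _ "2*n"]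
  have [simp]: "H \<in> carrier_mat ?N ?N" "C \<in> carrier_mat ?N ?N" "E \<in> carrier_mat ?N ?N"
    by (simp_all add: H_def C_def E_def)
  have [simp]: "S \<in> carrier_mat ?N ?N" unfolding S by (simp flip: H_def C_def)
  note assoc = assoc_mult_mat[of _ ?N ?N _ ?N _ ?N]
  have "mat_adjoint H = H" unfolding H_def by (rule hyperbolic_mat_adjoint)
  then have "S * iJ_mat n * mat_adjoint S * (U * R) = U * (H * (C * iJ_mat n * mat_adjoint C) * H) * (mat_adjoint U * U) * R"
    unfolding S H_def[symmetric] C_def[symmetric]
    by (simp add: mat_adjoint_mult[of _ ?N ?N _ ?N] assoc)
  also have "C * iJ_mat n * mat_adjoint C = iJ_mat n"
    unfolding C_def by (rule symplectic_real_iJ[OF Y])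
  also have "H * iJ_mat n * H = R * E * mat_adjoint R"
    unfolding H_def R_def E_def by (rule hyperbolic_mat_iJ)
  also have "U * (R * E * mat_adjoint R) * (mat_adjoint U * U) * R = (U * R) * (E * (mat_adjoint R * R))"
    unfolding unitary_left_inv[OF U] by (simp add: assoc left_mult_one_mat[of _ ?N ?N])
  also have "\<dots> = (U * R) * E"
    unfolding unitary_left_inv[OF R] by (simp add: right_mult_one_mat[of _ ?N ?N])
  finally show ?thesis
    unfolding E_def by (intro char_poly_unitary_diag[OF _ unitary_mult[OF U R]]) simp
qed

text \<open>The positive members are exactly the n values exp (2 \<theta>), because all entries from
  index n on are negative. Taking half the logarithm recovers the parameters with their signs, so
  the permutation found gives plain equality in every case.\<close>

lemma eq_up_to_order_and_signs_if_eigenvalues: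
  assumes "mset (map (hyperbolic_eigenvalue n \<theta>) [0..<2 * n]) = mset (map (hyperbolic_eigenvalue n \<theta>') [0..<2 * n])"
  shows "eq_up_to_order_and_signs n \<theta> \<theta>'"
proof -
  have pos: "filter_mset (\<lambda>x. x > 0) (mset (map (hyperbolic_eigenvalue n \<theta>) [0..<2 * n])) =
      mset (map (\<lambda>i. exp (2 * \<theta> i)) [0..<n])" for \<theta>
  proof -
    have "filter (\<lambda>x. x > 0) (map (hyperbolic_eigenvalue n \<theta>) [0..<n]) = map (\<lambda>i. exp (2 * \<theta> i)) [0..<n]"
      by (subst filter_True) (auto simp: hyperbolic_eigenvalue_def)
    moreover have "filter (\<lambda>x. x > 0) (map (hyperbolic_eigenvalue n \<theta>) [n..<2 * n]) = []"
      by (subst filter_False) (auto simp: hyperbolic_eigenvalue_def not_less)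
    moreover have "[0..<2 * n] = [0..<n] @ [n..<2 * n]"
      by (metis le0 mult_2 upt_add_eq_append)
    ultimately show ?thesis by (simp only: map_append filter_append append_Nil2 flip: mset_filter)
  qed
  have "mset (map (\<lambda>i. exp (2 * \<theta>' i)) [0..<n]) = mset (map (\<lambda>i. exp (2 * \<theta> i)) [0..<n])"
    using assms by (simp only: flip: pos)
  from arg_cong[OF this, of "image_mset (\<lambda>x. ln x / 2)"]
  have "mset (map \<theta>' [0..<n]) = mset (map \<theta> [0..<n])"
    by (simp add: multiset.map_comp comp_def)
  then obtain p where p: "p permutes {..<length (map \<theta> [0..<n])}"
    "permute_list p (map \<theta> [0..<n]) = map \<theta>' [0..<n]"
    by (rule mset_eq_permutation)
  have "\<theta>' i = \<theta> (p i)" if "i < n" for i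
  proof -
    have "p i < n" using permutes_in_image[OF p(1), of i] that by simp
    moreover have "map \<theta>' [0..<n] ! i = map \<theta> [0..<n] ! p i"
      unfolding p(2)[symmetric] by (rule permute_list_nth[OF p(1)]) (use that in simp)
    ultimately show ?thesis using that by simp
  qed
  then show ?thesis
    using p(1) unfolding eq_up_to_order_and_signs_def by auto
qed

theorem theorem6p8:
  fixes n :: nat and S :: "complex mat"
  assumes "symplectic n S"
  shows "\<exists>(U :: complex mat) (Y :: real mat) (\<theta> :: nat \<Rightarrow> real).
    unitary (2 * n) U \<and> symplectic n U \<and> symplectic n Y \<and>
    S = U * hyperbolic_mat n \<theta> * map_mat complex_of_real Y \<and>
    (\<forall>(U' :: complex mat) (Y' :: real mat) (\<theta>' :: nat \<Rightarrow> real).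
       unitary (2 * n) U' \<and> symplectic n U' \<and> symplectic n Y' \<and>
       S = U' * hyperbolic_mat n \<theta>' * map_mat complex_of_real Y' \<longrightarrow>
       eq_up_to_order_and_signs n \<theta> \<theta>')"
proof -
  obtain U Y \<theta> where U: "unitary (2 * n) U" "symplectic n U" and Y: "symplectic n Y"
    and S: "S = U * hyperbolic_mat n \<theta> * map_mat complex_of_real Y"
    using decomposition_exists[OF assms] by blast
  have "eq_up_to_order_and_signs n \<theta> \<theta>'"
    if "unitary (2 * n) U'" "symplectic n Y'"
      "S = U' * hyperbolic_mat n \<theta>' * map_mat complex_of_real Y'" for U' Y' \<theta>'
  proof -
    have "mset (map (\<lambda>i. complex_of_real (hyperbolic_eigenvalue n \<theta> i)) [0..<2 * n]) =
        mset (map (\<lambda>i. complex_of_real (hyperbolic_eigenvalue n \<theta>' i)) [0..<2 * n])"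
      using decomposition_char_poly[OF U(1) Y S] decomposition_char_poly[OF that]
      by (intro mset_roots_unique) (simp only:)
    from arg_cong[OF this, of "image_mset Re"]
    have "mset (map (hyperbolic_eigenvalue n \<theta>) [0..<2 * n]) =
        mset (map (hyperbolic_eigenvalue n \<theta>') [0..<2 * n])"
      by (simp add: multiset.map_comp comp_def)
    then show ?thesis by (rule eq_up_to_order_and_signs_if_eigenvalues)
  qed
  then show ?thesis using U Y S by blast
qed

end
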